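(* Let $R$ be a commutative ring with $1\neq0$ and let $S$ be a strongly multiplicative set of $R$. Then extension and contraction along the localization map $R\to R_S$ induce a bijection between $\operatorname{Max}(R_S)$ and $\{M\in\operatorname{Max}(R): M\cap S=\varnothing\}$.
   Context: $\operatorname{Max}(A)$ denotes the set of maximal ideals of a ring $A$, and $R_S$ is the localization of $R$ at $S$. A multiplicative set $S$ of a commutative ring $R$ is a subset with $0\notin S$, $1\in S$, and $st\in S$ for all $s,t\in S$. It is strongly multiplicative if $\bigl(\bigcap_{i\in\Delta}s_iR\bigr)\cap S\neq\varnothing$ for every family $(s_i)_{i\in\Delta}$ of elements of $S$. *)

theory Defs
  imports "HOL-Algebra.Ideal"
begin

definition multiplicative_set :: "('a, 'm) ring_scheme \<Rightarrow> 'a set \<Rightarrow> bool"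
  where "multiplicative_set R S \<longleftrightarrow> submonoid S R \<and> \<zero>\<^bsub>R\<^esub> \<notin> S"

text \<open>
  The intersection over a family of elements of \<open>S\<close> depends only on the set \<open>T\<close> of its members,
  so families of arbitrary index are rendered as subsets of \<open>S\<close>. For \<open>T = {}\<close> the intersection is
  \<open>UNIV\<close> instead of \<open>carrier R\<close>, which makes no difference after intersecting with \<open>S\<close>.
\<close>

definition strongly_multiplicative_set :: "('a, 'm) ring_scheme \<Rightarrow> 'a set \<Rightarrow> bool"
  where "strongly_multiplicative_set R S \<longleftrightarrow>
    multiplicative_set R S \<and> (\<forall>T. T \<subseteq> S \<longrightarrow> (\<Inter>s\<in>T. PIdl\<^bsub>R\<^esub> s) \<inter> S \<noteq> {})"

definition maximal_ideals :: "('a, 'm) ring_scheme \<Rightarrow> 'a set set"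
  where "maximal_ideals R = {M. maximalideal M R}"

text \<open>
  The localization is the set of equivalence classes of pairs \<open>(a, s)\<close>, standing for \<open>a/s\<close>, where
  \<open>a/s = b/t\<close> iff \<open>u (a t - b s) = 0\<close> for some \<open>u\<close> in \<open>S\<close>.
\<close>

definition fraction_rel :: "('a, 'm) ring_scheme \<Rightarrow> 'a set \<Rightarrow> (('a \<times> 'a) \<times> ('a \<times> 'a)) set"
  where "fraction_rel R S =
    {((a, s), (b, t)). a \<in> carrier R \<and> s \<in> S \<and> b \<in> carrier R \<and> t \<in> S \<and>
       (\<exists>u\<in>S. u \<otimes>\<^bsub>R\<^esub> (a \<otimes>\<^bsub>R\<^esub> t \<ominus>\<^bsub>R\<^esub> b \<otimes>\<^bsub>R\<^esub> s) = \<zero>\<^bsub>R\<^esub>)}"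

definition fraction :: "('a, 'm) ring_scheme \<Rightarrow> 'a set \<Rightarrow> 'a \<Rightarrow> 'a \<Rightarrow> ('a \<times> 'a) set"
  where "fraction R S a s = fraction_rel R S `` {(a, s)}"

text \<open>
  As usual for quotients by an equivalence relation (cf. \<open>UN_equiv_class2\<close>), the union over all
  representatives is the common value of the class on any of them.
\<close>

definition localization :: "('a, 'm) ring_scheme \<Rightarrow> 'a set \<Rightarrow> ('a \<times> 'a) set ring"
  where "localization R S =
    \<lparr>carrier = (carrier R \<times> S) // fraction_rel R S,
     mult = (\<lambda>X Y. \<Union>(a, s)\<in>X. \<Union>(b, t)\<in>Y. fraction R S (a \<otimes>\<^bsub>R\<^esub> b) (s \<otimes>\<^bsub>R\<^esub> t)),
     one = fraction R S \<one>\<^bsub>R\<^esub> \<one>\<^bsub>R\<^esub>,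
     zero = fraction R S \<zero>\<^bsub>R\<^esub> \<one>\<^bsub>R\<^esub>,
     add = (\<lambda>X Y. \<Union>(a, s)\<in>X. \<Union>(b, t)\<in>Y.
              fraction R S (a \<otimes>\<^bsub>R\<^esub> t \<oplus>\<^bsub>R\<^esub> b \<otimes>\<^bsub>R\<^esub> s) (s \<otimes>\<^bsub>R\<^esub> t))\<rparr>"

definition localization_map :: "('a, 'm) ring_scheme \<Rightarrow> 'a set \<Rightarrow> 'a \<Rightarrow> ('a \<times> 'a) set"
  where "localization_map R S a = fraction R S a \<one>\<^bsub>R\<^esub>"

definition extension :: "('b, 'n) ring_scheme \<Rightarrow> ('a \<Rightarrow> 'b) \<Rightarrow> 'a set \<Rightarrow> 'b set"
  where "extension B f I = Idl\<^bsub>B\<^esub> (f ` I)"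

definition contraction :: "('a, 'm) ring_scheme \<Rightarrow> ('a \<Rightarrow> 'b) \<Rightarrow> 'b set \<Rightarrow> 'a set"
  where "contraction A f J = {a \<in> carrier A. f a \<in> J}"

end

theory Submission
  imports Defs "HOL-Algebra.QuotRing" "HOL-Algebra.Multiplicative_Group"
begin

text \<open>
  Applied to the family of all elements of \<open>S\<close>, strong multiplicativity yields a \<open>w\<close> in \<open>S\<close> that
  every element of \<open>S\<close> divides. For \<open>s\<close> in \<open>S\<close> also \<open>w s\<close> divides \<open>w\<close>, say \<open>w = x w s\<close>, hence
  \<open>1/s = x/1\<close>, and the localization map is onto. So the maximal ideals of the localization
  correspond to the maximal ideals of \<open>R\<close> above the kernel. As maximal ideals are prime, these are
  the maximal ideals disjoint from \<open>S\<close>.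
\<close>

section \<open>Maximal ideals and surjective homomorphisms\<close>

locale surjective_ring_hom = ring_hom_ring +
  assumes surj: "h ` carrier R = carrier S"
begin

text \<open>Surjectivity is essential for absorption: every scalar of the codomain is an image, so
  multiplying by it can be carried out upstairs.\<close>

lemma ideal_image:
  assumes "ideal I R"
  shows "ideal (h ` I) S"
proof -
  interpret I: ideal I R by fact
  have sub: "I \<subseteq> carrier R" by (rule I.a_subset)
  show ?thesis
  proof (rule idealI)
    show "ring S" by (rule S.ring_axioms)
    interpret add_hom: group_hom "add_monoid R" "add_monoid S" h
      by (rule a_group_hom)
    show "subgroup (h ` I) (add_monoid S)"
      by (rule add_hom.subgroup_img_is_subgroup[OF I.a_subgroup])
  next
    fix a x assume "a \<in> h ` I" "x \<in> carrier S"
    then obtain i r where i: "i \<in> I" "a = h i" and r: "r \<in> carrier R" "x = h r"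
      using surj by blast
    have "x \<otimes>\<^bsub>S\<^esub> a = h (r \<otimes> i)" "a \<otimes>\<^bsub>S\<^esub> x = h (i \<otimes> r)"
      using i r sub by auto
    then show "x \<otimes>\<^bsub>S\<^esub> a \<in> h ` I" "a \<otimes>\<^bsub>S\<^esub> x \<in> h ` I"
      using I.I_l_closed[OF i(1) r(1)] I.I_r_closed[OF i(1) r(1)] by (simp_all only: imageI)
  qed
qed

text \<open>Two elements with the same image differ by an element of the kernel, and
  \<open>I\<close> absorbs that difference.\<close>

lemma vimage_image:
  assumes "ideal I R" and ker: "a_kernel R S h \<subseteq> I"
  shows "{r \<in> carrier R. h r \<in> h ` I} = I"
proof -
  interpret I: ideal I R by fact
  have "r \<in> I" if r: "r \<in> carrier R" and i: "i \<in> I" and eq: "h r = h i" for r i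
  proof -
    obtain k where k: "k \<in> a_kernel R S h" "r = k \<oplus> i"
      using homeq_imp_rcos[OF I.a_Hcarr[OF i] r eq] by (auto simp: a_r_coset_def')
    then show ?thesis
      using ker i I.a_closed by blast
  qed
  then show ?thesis
    using I.a_subset by blast
qed

lemma image_vimage:
  assumes "J \<subseteq> carrier S"
  shows "h ` {r \<in> carrier R. h r \<in> J} = J"
proof -
  have "J \<subseteq> h ` carrier R" using assms by (simp only: surj)
  then show ?thesis by auto
qed

text \<open>An ideal above the preimage contains the kernel and is therefore determined by its
  image, which lies above \<open>N\<close>. This fails without surjectivity: the zero ideal of the
  rationals contracts to the zero ideal of the integers.\<close>

lemma maximalideal_vimage:
  assumes "maximalideal N S"
  shows "maximalideal {r \<in> carrier R. h r \<in> N} R"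
proof -
  interpret N: maximalideal N S by fact
  let ?M = "{r \<in> carrier R. h r \<in> N}"
  have img: "h ` ?M = N"
    by (rule image_vimage[OF N.a_subset])
  show ?thesis
  proof (rule maximalidealI)
    show "ideal ?M R"
      by (rule ideal_vimage[OF N.is_ideal])
    show "carrier R \<noteq> ?M"
    proof
      assume "carrier R = ?M"
      then have "h ` carrier R = h ` ?M" by (rule arg_cong)
      then show False unfolding img surj by (rule notE[OF N.I_notcarr])
    qed
  next
    fix J assume J: "ideal J R" "?M \<subseteq> J" "J \<subseteq> carrier R"
    have "a_kernel R S h \<subseteq> ?M"
      unfolding a_kernel_def' using N.zero_closed by (metis (mono_tags, lifting) Collect_mono)
    then have J_eq: "{r \<in> carrier R. h r \<in> h ` J} = J"
      using vimage_image[OF J(1)] J(2) by blast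
    have "h ` J = N \<or> h ` J = carrier S"
    proof (rule N.I_maximal)
      show "ideal (h ` J) S" by (rule ideal_image[OF J(1)])
      show "N \<subseteq> h ` J" using img J(2) by blast
      show "h ` J \<subseteq> carrier S" using J(3) surj by blast
    qed
    then show "J = ?M \<or> J = carrier R"
    proof
      assume "h ` J = N"
      then show ?thesis using J_eq by simp
    next
      assume "h ` J = carrier S"
      then have "J = carrier R" using J_eq by auto
      then show ?thesis ..
    qed
  qed
qed

text \<open>Ideals above the image pull back to ideals above \<open>M\<close>, where maximality
  leaves two choices; surjectivity carries these choices back down.\<close>

lemma maximalideal_image:
  assumes "maximalideal M R" and "a_kernel R S h \<subseteq> M"
  shows "maximalideal (h ` M) S"
proof -
  interpret M: maximalideal M R by fact
  have M_eq: "{r \<in> carrier R. h r \<in> h ` M} = M"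
    by (rule vimage_image[OF M.is_ideal assms(2)])
  show ?thesis
  proof (rule maximalidealI)
    show "ideal (h ` M) S"
      by (rule ideal_image[OF M.is_ideal])
    show "carrier S \<noteq> h ` M"
    proof
      assume "carrier S = h ` M"
      then have "carrier R \<subseteq> {r \<in> carrier R. h r \<in> h ` M}" using surj by blast
      then show False unfolding M_eq using M.I_notcarr M.a_subset by blast
    qed
  next
    fix K assume K: "ideal K S" "h ` M \<subseteq> K" "K \<subseteq> carrier S"
    let ?J = "{r \<in> carrier R. h r \<in> K}"
    have "?J = M \<or> ?J = carrier R"
      using M.I_maximal[OF ideal_vimage[OF K(1)]] K(2) M.a_subset by blast
    then show "K = h ` M \<or> K = carrier S"
      using image_vimage[OF K(3)] surj by metis
  qed
qed

text \<open>The image is already an ideal, so passing to the generated ideal adds nothing.\<close>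

lemma extension_eq_image:
  assumes "ideal I R"
  shows "extension S h I = h ` I"
  unfolding extension_def
  using S.genideal_minimal[OF ideal_image[OF assms] subset_refl]
    S.genideal_self[of "h ` I"] ideal.Icarr[OF ideal_image[OF assms]] by blast

end

section \<open>The localization map\<close>

locale cring_submonoid = cring R + submonoid S R for R (structure) and S
begin

section \<open>Equality of fractions\<close>

text \<open>Removing the subtraction lets equalities of fractions be checked by rearranging
  products.\<close>

lemma in_fraction_rel_iff:
  assumes "a \<in> carrier R" "s \<in> S" "b \<in> carrier R" "t \<in> S"
  shows "((a, s), (b, t)) \<in> fraction_rel R S \<longleftrightarrow> (\<exists>u\<in>S. u \<otimes> (a \<otimes> t) = u \<otimes> (b \<otimes> s))"
proof -
  have "u \<otimes> (a \<otimes> t \<ominus> b \<otimes> s) = \<zero> \<longleftrightarrow> u \<otimes> (a \<otimes> t) = u \<otimes> (b \<otimes> s)" if "u \<in> S" for u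
  proof -
    have "u \<otimes> (a \<otimes> t \<ominus> b \<otimes> s) = u \<otimes> (a \<otimes> t) \<ominus> u \<otimes> (b \<otimes> s)"
      using that assms by (simp add: a_minus_def r_distr r_minus)
    then show ?thesis
      using that assms by (simp add: r_right_minus_eq)
  qed
  then show ?thesis
    using assms by (simp add: fraction_rel_def)
qed

lemma equiv_fraction_rel: "equiv (carrier R \<times> S) (fraction_rel R S)"
proof (rule equivI)
  show "fraction_rel R S \<subseteq> (carrier R \<times> S) \<times> (carrier R \<times> S)"
    by (auto simp: fraction_rel_def)
  show "refl_on (carrier R \<times> S) (fraction_rel R S)"
    using one_closed by (auto intro!: refl_onI simp: in_fraction_rel_iff)
  have carrier: "p \<in> carrier R \<times> S \<and> q \<in> carrier R \<times> S" if "(p, q) \<in> fraction_rel R S" for p q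
    using that by (auto simp: fraction_rel_def)
  show "sym (fraction_rel R S)"
  proof (rule symI)
    fix p q assume pq: "(p, q) \<in> fraction_rel R S"
    obtain a s b t where "p = (a, s)" "q = (b, t)" by (metis surj_pair)
    then show "(q, p) \<in> fraction_rel R S"
      using pq carrier[OF pq] by (auto simp: in_fraction_rel_iff) metis
  qed
  show "trans (fraction_rel R S)"
  proof (rule transI)
    fix p q o' assume pq: "(p, q) \<in> fraction_rel R S" and qo: "(q, o') \<in> fraction_rel R S"
    obtain a s b t c r where eqs: "p = (a, s)" "q = (b, t)" "o' = (c, r)" by (metis surj_pair)
    have mem: "a \<in> carrier R" "b \<in> carrier R" "c \<in> carrier R" "s \<in> S" "t \<in> S" "r \<in> S"
      using carrier[OF pq] carrier[OF qo] eqs by auto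
    obtain u v where u: "u \<in> S" "u \<otimes> (a \<otimes> t) = u \<otimes> (b \<otimes> s)"
      and v: "v \<in> S" "v \<otimes> (b \<otimes> r) = v \<otimes> (c \<otimes> t)"
      using pq qo mem by (auto simp: eqs in_fraction_rel_iff)
    \<comment> \<open>The equation for \<open>u\<close> is multiplied by
      \<open>v \<otimes> r\<close> and the one for \<open>v\<close> by \<open>u \<otimes> s\<close>.
      The middle denominator \<open>t\<close> cannot be cancelled and joins the witness
      \<open>u \<otimes> v \<otimes> t\<close>.\<close>
    have "(u \<otimes> v \<otimes> t) \<otimes> (a \<otimes> r) = (v \<otimes> r) \<otimes> (u \<otimes> (a \<otimes> t))"
      using mem u(1) v(1) by (simp add: m_ac)
    also have "\<dots> = (v \<otimes> r) \<otimes> (u \<otimes> (b \<otimes> s))"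
      by (simp only: u(2))
    also have "\<dots> = (u \<otimes> s) \<otimes> (v \<otimes> (b \<otimes> r))"
      using mem u(1) v(1) by (simp add: m_ac)
    also have "\<dots> = (u \<otimes> s) \<otimes> (v \<otimes> (c \<otimes> t))"
      by (simp only: v(2))
    also have "\<dots> = (u \<otimes> v \<otimes> t) \<otimes> (c \<otimes> s)"
      using mem u(1) v(1) by (simp add: m_ac)
    finally show "(p, o') \<in> fraction_rel R S"
      using mem u(1) v(1) unfolding eqs by (auto simp: in_fraction_rel_iff)
  qed
qed

lemma fraction_eq_iff:
  assumes "a \<in> carrier R" "s \<in> S" "b \<in> carrier R" "t \<in> S"
  shows "fraction R S a s = fraction R S b t \<longleftrightarrow> (\<exists>u\<in>S. u \<otimes> (a \<otimes> t) = u \<otimes> (b \<otimes> s))"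
  unfolding fraction_def
  using eq_equiv_class_iff[OF equiv_fraction_rel] assms by (simp add: in_fraction_rel_iff)

section \<open>Arithmetic of fractions\<close>

text \<open>The unions defining the product collapse once the value is independent of
  representatives. By commutativity, changing the second factor alone is enough.\<close>

lemma fraction_mult:
  assumes "a \<in> carrier R" "s \<in> S" "b \<in> carrier R" "t \<in> S"
  shows "fraction R S a s \<otimes>\<^bsub>localization R S\<^esub> fraction R S b t = fraction R S (a \<otimes> b) (s \<otimes> t)"
proof -
  have "congruent2 (fraction_rel R S) (fraction_rel R S)
      (\<lambda>(a, s) (b, t). fraction R S (a \<otimes> b) (s \<otimes> t))"
  proof (rule congruent2_commuteI[OF equiv_fraction_rel])
    fix p q assume "p \<in> carrier R \<times> S" "q \<in> carrier R \<times> S"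
    then show "(case p of (a, s) \<Rightarrow> \<lambda>(b, t). fraction R S (a \<otimes> b) (s \<otimes> t)) q =
        (case q of (a, s) \<Rightarrow> \<lambda>(b, t). fraction R S (a \<otimes> b) (s \<otimes> t)) p"
      by (auto simp: m_comm)
  next
    fix p q q' assume p: "p \<in> carrier R \<times> S" and qq: "(q, q') \<in> fraction_rel R S"
    obtain c r a s b t where eqs: "p = (c, r)" "q = (a, s)" "q' = (b, t)" by (metis surj_pair)
    have mem: "c \<in> carrier R" "a \<in> carrier R" "b \<in> carrier R" "r \<in> S" "s \<in> S" "t \<in> S"
      using p qq by (auto simp: eqs fraction_rel_def)
    obtain u where u: "u \<in> S" "u \<otimes> (a \<otimes> t) = u \<otimes> (b \<otimes> s)"
      using qq mem by (auto simp: eqs in_fraction_rel_iff)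
    have "u \<otimes> (c \<otimes> a \<otimes> (r \<otimes> t)) = (c \<otimes> r) \<otimes> (u \<otimes> (a \<otimes> t))"
      using mem u(1) by (simp add: m_ac)
    also have "\<dots> = (c \<otimes> r) \<otimes> (u \<otimes> (b \<otimes> s))"
      by (simp only: u(2))
    also have "\<dots> = u \<otimes> (c \<otimes> b \<otimes> (r \<otimes> s))"
      using mem u(1) by (simp add: m_ac)
    finally show "(case p of (a, s) \<Rightarrow> \<lambda>(b, t). fraction R S (a \<otimes> b) (s \<otimes> t)) q =
        (case p of (a, s) \<Rightarrow> \<lambda>(b, t). fraction R S (a \<otimes> b) (s \<otimes> t)) q'"
      using mem u(1) by (auto simp: eqs fraction_eq_iff)
  qed
  from UN_equiv_class2[OF equiv_fraction_rel equiv_fraction_rel this] show ?thesis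
    using assms by (simp add: localization_def fraction_def[of R S a s] fraction_def[of R S b t]
        case_prod_unfold)
qed

lemma fraction_add:
  assumes "a \<in> carrier R" "s \<in> S" "b \<in> carrier R" "t \<in> S"
  shows "fraction R S a s \<oplus>\<^bsub>localization R S\<^esub> fraction R S b t
    = fraction R S (a \<otimes> t \<oplus> b \<otimes> s) (s \<otimes> t)"
proof -
  have "congruent2 (fraction_rel R S) (fraction_rel R S)
      (\<lambda>(a, s) (b, t). fraction R S (a \<otimes> t \<oplus> b \<otimes> s) (s \<otimes> t))"
  proof (rule congruent2_commuteI[OF equiv_fraction_rel])
    fix p q assume "p \<in> carrier R \<times> S" "q \<in> carrier R \<times> S"
    then show "(case p of (a, s) \<Rightarrow> \<lambda>(b, t). fraction R S (a \<otimes> t \<oplus> b \<otimes> s) (s \<otimes> t)) q =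
        (case q of (a, s) \<Rightarrow> \<lambda>(b, t). fraction R S (a \<otimes> t \<oplus> b \<otimes> s) (s \<otimes> t)) p"
      by (auto simp: m_comm a_comm)
  next
    fix p q q' assume p: "p \<in> carrier R \<times> S" and qq: "(q, q') \<in> fraction_rel R S"
    obtain c r a s b t where eqs: "p = (c, r)" "q = (a, s)" "q' = (b, t)" by (metis surj_pair)
    have mem: "c \<in> carrier R" "a \<in> carrier R" "b \<in> carrier R" "r \<in> S" "s \<in> S" "t \<in> S"
      using p qq by (auto simp: eqs fraction_rel_def)
    obtain u where u: "u \<in> S" "u \<otimes> (a \<otimes> t) = u \<otimes> (b \<otimes> s)"
      using qq mem by (auto simp: eqs in_fraction_rel_iff)
    \<comment> \<open>The witness \<open>u\<close> serves again: the summand with \<open>c\<close>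
      agrees on both sides up to order, and the other one is \<open>r \<otimes> r\<close> times the
      given equation.\<close>
    have "u \<otimes> ((c \<otimes> s \<oplus> a \<otimes> r) \<otimes> (r \<otimes> t))
        = u \<otimes> (c \<otimes> s \<otimes> (r \<otimes> t)) \<oplus> (r \<otimes> r) \<otimes> (u \<otimes> (a \<otimes> t))"
      using mem u(1) by (simp add: l_distr r_distr m_ac)
    also have "\<dots> = u \<otimes> (c \<otimes> s \<otimes> (r \<otimes> t)) \<oplus> (r \<otimes> r) \<otimes> (u \<otimes> (b \<otimes> s))"
      by (simp only: u(2))
    also have "\<dots> = u \<otimes> ((c \<otimes> t \<oplus> b \<otimes> r) \<otimes> (r \<otimes> s))"
      using mem u(1) by (simp add: l_distr r_distr m_ac)
    finally show "(case p of (a, s) \<Rightarrow> \<lambda>(b, t). fraction R S (a \<otimes> t \<oplus> b \<otimes> s) (s \<otimes> t)) q =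
        (case p of (a, s) \<Rightarrow> \<lambda>(b, t). fraction R S (a \<otimes> t \<oplus> b \<otimes> s) (s \<otimes> t)) q'"
      using mem u(1) by (auto simp: eqs fraction_eq_iff)
  qed
  from UN_equiv_class2[OF equiv_fraction_rel equiv_fraction_rel this] show ?thesis
    using assms by (simp add: localization_def fraction_def[of R S a s] fraction_def[of R S b t]
        case_prod_unfold)
qed

lemma carrier_localization:
  "carrier (localization R S) = {fraction R S a s | a s. a \<in> carrier R \<and> s \<in> S}"
  by (auto simp: localization_def fraction_def quotient_def)

section \<open>The localization map as a homomorphism\<close>

text \<open>Membership in \<open>ring_hom\<close> does not presuppose that the target is a ring, so
  it can later serve to prove that it is one.\<close>

lemma localization_map_hom: "localization_map R S \<in> ring_hom R (localization R S)"
proof (rule ring_hom_memI)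
  show "localization_map R S \<one> = \<one>\<^bsub>localization R S\<^esub>"
    by (simp add: localization_map_def localization_def)
next
  fix x y assume xy: "x \<in> carrier R" "y \<in> carrier R"
  then show "localization_map R S x \<in> carrier (localization R S)"
    using one_closed by (simp only: localization_map_def carrier_localization) blast
  show "localization_map R S (x \<otimes> y)
      = localization_map R S x \<otimes>\<^bsub>localization R S\<^esub> localization_map R S y"
    using xy by (simp add: localization_map_def fraction_mult)
  show "localization_map R S (x \<oplus> y)
      = localization_map R S x \<oplus>\<^bsub>localization R S\<^esub> localization_map R S y"
    using xy by (simp add: localization_map_def fraction_add)
qed

lemma localization_map_eq_iff:
  assumes "a \<in> carrier R" "b \<in> carrier R"
  shows "localization_map R S a = localization_map R S b \<longleftrightarrow> (\<exists>u\<in>S. u \<otimes> a = u \<otimes> b)"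
  using assms by (simp add: localization_map_def fraction_eq_iff)

lemma localization_map_zero: "localization_map R S \<zero> = \<zero>\<^bsub>localization R S\<^esub>"
  by (simp add: localization_map_def localization_def)

text \<open>The ring axioms need no verification on fractions: a homomorphic image of a ring is a
  ring, and by surjectivity this image is the whole localization.\<close>

lemma surjective_ring_hom_localization_map:
  assumes surj: "localization_map R S ` carrier R = carrier (localization R S)"
  shows "surjective_ring_hom R (localization R S) (localization_map R S)"
proof -
  have "ring (localization R S)"
    using ring_hom_imp_img_ring[OF localization_map_hom]
    by (simp add: surj localization_map_zero)
  then have "ring_hom_ring R (localization R S) (localization_map R S)"
    by (rule ring_hom_ringI2[OF ring_axioms _ localization_map_hom])
  then show ?thesis
    using surj by (intro surjective_ring_hom.intro surjective_ring_hom_axioms.intro)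
qed

text \<open>An element of the kernel is killed by some \<open>u\<close> in \<open>S\<close>. The
  product zero lies in \<open>P\<close> while \<open>u\<close> does not, so primality puts the other
  factor in \<open>P\<close>.\<close>

lemma kernel_subset_primeideal:
  assumes "primeideal P R" "P \<inter> S = {}"
  shows "a_kernel R (localization R S) (localization_map R S) \<subseteq> P"
proof
  interpret P: primeideal P R by fact
  fix a assume "a \<in> a_kernel R (localization R S) (localization_map R S)"
  then have a: "a \<in> carrier R" "localization_map R S a = localization_map R S \<zero>"
    by (auto simp: a_kernel_def' localization_map_zero)
  then obtain u where u: "u \<in> S" "u \<otimes> a = \<zero>"
    by (auto simp: localization_map_eq_iff)
  then have "u \<otimes> a \<in> P"
    by (simp add: P.zero_closed)
  then show "a \<in> P"
    using P.I_prime[of u a] a(1) u(1) assms(2) by auto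
qed

end

section \<open>Strong multiplicativity and surjectivity\<close>

locale cring_strongly_multiplicative = cring_submonoid +
  assumes strong: "strongly_multiplicative_set R S"
begin

lemma common_multiple:
  obtains w where "w \<in> S" "\<And>s. s \<in> S \<Longrightarrow> \<exists>x\<in>carrier R. w = x \<otimes> s"
proof -
  from strong have "(\<Inter>s\<in>S. PIdl s) \<inter> S \<noteq> {}"
    by (simp add: strongly_multiplicative_set_def)
  then obtain w where "w \<in> S" "\<forall>s\<in>S. w \<in> PIdl s" by blast
  then have "\<exists>x\<in>carrier R. w = x \<otimes> s" if "s \<in> S" for s
    using that by (auto simp: cgenideal_def)
  with \<open>w \<in> S\<close> show thesis by (rule that)
qed

text \<open>Denominators can be cleared, as \<open>x\<close> maps to an inverse of the image of
  \<open>s\<close>. The inverse property serves to exclude \<open>s\<close> from contracted maximal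
  ideals, the formula for fractions to prove surjectivity.\<close>

lemma fraction_one_eq_localization_map:
  assumes s: "s \<in> S"
  obtains x where "x \<in> carrier R" "localization_map R S (x \<otimes> s) = \<one>\<^bsub>localization R S\<^esub>"
    "\<And>a. a \<in> carrier R \<Longrightarrow> fraction R S a s = localization_map R S (a \<otimes> x)"
proof -
  obtain w where w: "w \<in> S" "\<And>t. t \<in> S \<Longrightarrow> \<exists>x\<in>carrier R. w = x \<otimes> t"
    using common_multiple by blast
  \<comment> \<open>The element \<open>w \<otimes> s\<close> is again in \<open>S\<close>, so it
    divides \<open>w\<close> too.\<close>
  obtain x where x: "x \<in> carrier R" "w = x \<otimes> (w \<otimes> s)"
    using w s by blast
  have wx: "w \<otimes> (x \<otimes> s) = w"
    using x w(1) s by (metis m_lcomm mem_carrier)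
  show thesis
  proof (rule that[OF x(1)])
    \<comment> \<open>Here and in the formula for fractions, \<open>w\<close> itself is the
      multiplier from \<open>S\<close> that witnesses equality.\<close>
    have "localization_map R S (x \<otimes> s) = localization_map R S \<one>"
      using wx w(1) x(1) s by (auto simp: localization_map_eq_iff)
    then show "localization_map R S (x \<otimes> s) = \<one>\<^bsub>localization R S\<^esub>"
      by (simp add: localization_map_def localization_def)
  next
    fix a assume a: "a \<in> carrier R"
    have "w \<otimes> (a \<otimes> x \<otimes> s) = a \<otimes> (w \<otimes> (x \<otimes> s))"
      using a x(1) w(1) s by (simp add: m_ac)
    then have "w \<otimes> a = w \<otimes> (a \<otimes> x \<otimes> s)"
      using a w(1) by (simp add: wx m_comm)
    then show "fraction R S a s = localization_map R S (a \<otimes> x)"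
      using a x(1) w(1) s by (auto simp: localization_map_def fraction_eq_iff)
  qed
qed

lemma localization_map_surj: "localization_map R S ` carrier R = carrier (localization R S)"
proof
  show "localization_map R S ` carrier R \<subseteq> carrier (localization R S)"
    using ring_hom_closed[OF localization_map_hom] by blast
  show "carrier (localization R S) \<subseteq> localization_map R S ` carrier R"
  proof
    fix X assume "X \<in> carrier (localization R S)"
    then obtain a s where X: "X = fraction R S a s" "a \<in> carrier R" "s \<in> S"
      by (auto simp: carrier_localization)
    then obtain x where "x \<in> carrier R" "X = localization_map R S (a \<otimes> x)"
      using fraction_one_eq_localization_map by metis
    then show "X \<in> localization_map R S ` carrier R"
      using X(2) by blast
  qed
qed

text \<open>From here on the correspondence of ideals for surjective homomorphisms applies to the
  localization map.\<close>

sublocale loc: surjective_ring_hom R "localization R S" "localization_map R S"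
  by (rule surjective_ring_hom_localization_map[OF localization_map_surj])

section \<open>The correspondence of maximal ideals\<close>

text \<open>Elements of \<open>S\<close> become units in the localization, and a proper ideal
  contains no unit.\<close>

lemma contraction_disjoint:
  assumes "maximalideal N (localization R S)"
  shows "contraction R (localization_map R S) N \<inter> S = {}"
proof (rule ccontr)
  interpret N: maximalideal N "localization R S" by fact
  assume "contraction R (localization_map R S) N \<inter> S \<noteq> {}"
  then obtain s where s: "s \<in> S" "localization_map R S s \<in> N"
    by (auto simp: contraction_def)
  obtain x where x: "x \<in> carrier R" "localization_map R S (x \<otimes> s) = \<one>\<^bsub>localization R S\<^esub>"
    using fraction_one_eq_localization_map[OF s(1)] by metis
  have "\<one>\<^bsub>localization R S\<^esub> \<in> N"
    using N.I_l_closed[OF s(2) loc.hom_closed[OF x(1)]] x s(1) by simp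
  then show False
    using N.one_imp_carrier N.I_notcarr by simp
qed

lemma contraction_maximal:
  assumes "N \<in> maximal_ideals (localization R S)"
  shows "contraction R (localization_map R S) N \<in> {M \<in> maximal_ideals R. M \<inter> S = {}}"
  using assms loc.maximalideal_vimage contraction_disjoint
  by (simp add: maximal_ideals_def contraction_def)

text \<open>Extension is the plain image here, and a surjection maps the preimage of
  \<open>N\<close> onto \<open>N\<close>.\<close>

lemma extension_contraction:
  assumes "N \<in> maximal_ideals (localization R S)"
  shows "extension (localization R S) (localization_map R S)
    (contraction R (localization_map R S) N) = N"
proof -
  interpret N: maximalideal N "localization R S"
    using assms by (simp add: maximal_ideals_def)
  show ?thesis
    using loc.extension_eq_image[OF loc.ideal_vimage[OF N.is_ideal]]
      loc.image_vimage[OF N.a_subset]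
    by (simp add: contraction_def)
qed

lemma extension_of_maximal:
  assumes "M \<in> {M \<in> maximal_ideals R. M \<inter> S = {}}"
  shows "extension (localization R S) (localization_map R S) M \<in> maximal_ideals (localization R S)"
    and "contraction R (localization_map R S)
      (extension (localization R S) (localization_map R S) M) = M"
proof -
  interpret M: maximalideal M R
    using assms by (simp add: maximal_ideals_def)
  \<comment> \<open>Disjointness from \<open>S\<close> enters only here: being prime,
    \<open>M\<close> then contains the kernel, which both claims require.\<close>
  have ker: "a_kernel R (localization R S) (localization_map R S) \<subseteq> M"
    using kernel_subset_primeideal[OF maximalideal_prime[OF M.is_maximalideal]] assms by simp
  show "extension (localization R S) (localization_map R S) M \<in> maximal_ideals (localization R S)"
    using loc.maximalideal_image[OF M.is_maximalideal ker]
    by (simp add: maximal_ideals_def loc.extension_eq_image[OF M.is_ideal])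
  show "contraction R (localization_map R S)
      (extension (localization R S) (localization_map R S) M) = M"
    using loc.vimage_image[OF M.is_ideal ker]
    by (simp add: contraction_def loc.extension_eq_image[OF M.is_ideal])
qed

end

theorem theorem6p4:
  fixes R :: "('a, 'm) ring_scheme" and S :: "'a set"
  assumes "cring R" and "\<one>\<^bsub>R\<^esub> \<noteq> \<zero>\<^bsub>R\<^esub>"
    and "strongly_multiplicative_set R S"
  shows "bij_betw (extension (localization R S) (localization_map R S))
           {M \<in> maximal_ideals R. M \<inter> S = {}} (maximal_ideals (localization R S)) \<and>
         bij_betw (contraction R (localization_map R S))
           (maximal_ideals (localization R S)) {M \<in> maximal_ideals R. M \<inter> S = {}} \<and>
         (\<forall>M\<in>{M \<in> maximal_ideals R. M \<inter> S = {}}.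
           contraction R (localization_map R S)
             (extension (localization R S) (localization_map R S) M) = M) \<and>
         (\<forall>N\<in>maximal_ideals (localization R S).
           extension (localization R S) (localization_map R S)
             (contraction R (localization_map R S) N) = N)"
proof -
  interpret R: cring R by fact
  interpret submonoid S R
    using assms(3) by (simp add: strongly_multiplicative_set_def multiplicative_set_def)
  interpret cring_strongly_multiplicative R S
    by unfold_locales (rule assms(3))
  show ?thesis
    \<comment> \<open>Each of the two maps is the inverse that witnesses bijectivity of the
      other.\<close>
    by (intro conjI ballI bij_betw_byWitness[where f' = "contraction R (localization_map R S)"]
        bij_betw_byWitness[where f' = "extension (localization R S) (localization_map R S)"]
        image_subsetI extension_of_maximal extension_contraction contraction_maximal)
qed

end
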